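(* The maximum achievable rate of transmission with vanishing probability of error over a discrete memoryless channel with equiprobable binary inputs, output alphabet $\mathcal{Y}$, transition probabilities $p_{ij}$, $i=1,2$, $j=1,\ldots,|\mathcal{Y}|$, and maximum likelihood decoding according to a different set of transition probabilities $\widehat{p_{ij}}$, $i=1,2$, $j=1,\ldots,|\mathcal{Y}|$, is lower bounded by $$C_{P,\hat P}=\frac12\sum_{j=1}^{|\mathcal{Y}|}\left[p_{1j}\log(\widehat{p_{1j}})+p_{2j}\log(\widehat{p_{2j}})-(p_{1j}+p_{2j})\log\left(\frac{\widehat{p_{1j}}+\widehat{p_{2j}}}{2}\right)\right].$$
   Context: The input alphabet is $\{1,2\}$ and the output alphabet is the finite set $\mathcal{Y}=\{1,\ldots,|\mathcal{Y}|\}$. Equiprobable inputs means that the two input symbols are equally likely. The number $p_{ij}$ is the true probability of output $j$ given input $i$, and $\widehat{p_{ij}}$ is the decoder's estimate of it; both are transition probabilities, i.e. nonnegative with $\sum_j p_{ij}=\sum_j\widehat{p_{ij}}=1$ for $i=1,2$. Logarithms are in base 2, with the convention $0\cdot\log 0=0$; if $p_{ij}>0$ and $\widehat{p_{ij}}=0$ for some $i,j$, then $C_{P,\hat P}$ is taken to be $-\infty$. Channel: when $\mathbf{x}=(x_1,\ldots,x_n)\in\{1,2\}^n$ is transmitted, the probability of receiving $\mathbf{y}=(y_1,\ldots,y_n)\in\mathcal{Y}^n$ is $\prod_{i=1}^n p_{x_iy_i}$. Decoding: for a code $\mathcal{C}\subseteq\{1,2\}^n$ (of length $n$ and rate $\frac1n\log|\mathcal{C}|$),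 known to sender and receiver, the receiver does not know the $p_{ij}$ and uses the $\widehat{p_{ij}}$ instead: maximum likelihood decoding according to $\widehat{p_{ij}}$ means that a received $\mathbf{y}$ is decoded to $\hat{\mathbf{x}}=\arg\max_{\mathbf{x}\in\mathcal{C}}\prod_{i=1}^n\widehat{p_{x_iy_i}}$. An error occurs when $\hat{\mathbf{x}}$ differs from the transmitted codeword. Achievability has its usual meaning: a rate $R$ is achievable with vanishing probability of error if there are codes of length $n$, with rates tending to $R$ as $n\to\infty$, for which the maximum over the codewords of the probability of decoding error (under the true channel $p_{ij}$ and the decoder above) tends to $0$. *)

theory Defs
  imports Complex_Main "HOL-Library.FuncSet" "HOL-Library.Extended_Real"
begin

definition transition_probs :: "nat \<Rightarrow> (nat \<Rightarrow> nat \<Rightarrow> real) \<Rightarrow> bool" where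
  "transition_probs m p \<longleftrightarrow>
     (\<forall>i\<in>{1,2}. (\<forall>j\<in>{1..m}. 0 \<le> p i j) \<and> (\<Sum>j=1..m. p i j) = 1)"

abbreviation input_words :: "nat \<Rightarrow> (nat \<Rightarrow> nat) set" where
  "input_words n \<equiv> {1..n} \<rightarrow>\<^sub>E {1,2}"

abbreviation output_words :: "nat \<Rightarrow> nat \<Rightarrow> (nat \<Rightarrow> nat) set" where
  "output_words m n \<equiv> {1..n} \<rightarrow>\<^sub>E {1..m}"

definition word_prob :: "(nat \<Rightarrow> nat \<Rightarrow> real) \<Rightarrow> nat \<Rightarrow> (nat \<Rightarrow> nat) \<Rightarrow> (nat \<Rightarrow> nat) \<Rightarrow> real" where
  "word_prob p n x y = (\<Prod>i=1..n. p (x i) (y i))"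

definition is_code :: "nat \<Rightarrow> (nat \<Rightarrow> nat) set \<Rightarrow> bool" where
  "is_code n K \<longleftrightarrow> K \<subseteq> input_words n \<and> K \<noteq> {}"

definition rate :: "nat \<Rightarrow> (nat \<Rightarrow> nat) set \<Rightarrow> real" where
  "rate n K = log 2 (real (card K)) / real n"

definition ml_decoder ::
  "nat \<Rightarrow> (nat \<Rightarrow> nat \<Rightarrow> real) \<Rightarrow> nat \<Rightarrow> (nat \<Rightarrow> nat) set \<Rightarrow> ((nat \<Rightarrow> nat) \<Rightarrow> nat \<Rightarrow> nat) \<Rightarrow> bool" where
  "ml_decoder m q n K d \<longleftrightarrow>
     (\<forall>y\<in>output_words m n. is_arg_max (\<lambda>x. word_prob q n x y) (\<lambda>x. x \<in> K) (d y))"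

definition error_prob ::
  "nat \<Rightarrow> (nat \<Rightarrow> nat \<Rightarrow> real) \<Rightarrow> nat \<Rightarrow> ((nat \<Rightarrow> nat) \<Rightarrow> nat \<Rightarrow> nat) \<Rightarrow> (nat \<Rightarrow> nat) \<Rightarrow> real" where
  "error_prob m p n d x = (\<Sum>y | y \<in> output_words m n \<and> d y \<noteq> x. word_prob p n x y)"

definition max_error_prob ::
  "nat \<Rightarrow> (nat \<Rightarrow> nat \<Rightarrow> real) \<Rightarrow> nat \<Rightarrow> (nat \<Rightarrow> nat) set \<Rightarrow> ((nat \<Rightarrow> nat) \<Rightarrow> nat \<Rightarrow> nat) \<Rightarrow> real" where
  "max_error_prob m p n K d = (MAX x\<in>K. error_prob m p n d x)"

text \<open>
  The arg max need not be unique. Vanishing error is required for every decoder that selects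
  a maximiser, i.e. no matter how ties are broken.
\<close>

definition achieves ::
  "nat \<Rightarrow> (nat \<Rightarrow> nat \<Rightarrow> real) \<Rightarrow> (nat \<Rightarrow> nat \<Rightarrow> real) \<Rightarrow> (nat \<Rightarrow> (nat \<Rightarrow> nat) set) \<Rightarrow> real \<Rightarrow> bool" where
  "achieves m p q K R \<longleftrightarrow>
     (\<forall>n. is_code n (K n)) \<and>
     (\<lambda>n. rate n (K n)) \<longlonglongrightarrow> R \<and>
     (\<forall>d. (\<forall>n. ml_decoder m q n (K n) (d n)) \<longrightarrow>
          (\<lambda>n. max_error_prob m p n (K n) (d n)) \<longlonglongrightarrow> 0)"

text \<open>
  The relative frequency of a symbol is taken over all positions of all codewords: it is the
  probability of sending that symbol at a uniformly random time when the codewords are equally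
  likely. Equality with \<open>1/2\<close> is demanded in the limit only, as it can be impossible
  for a given code size and length (e.g. one codeword of odd length). The condition restricts
  the codes: without it, the supremum of the achievable rates can only be larger.
\<close>

definition symbol_frequency :: "nat \<Rightarrow> (nat \<Rightarrow> nat) set \<Rightarrow> nat \<Rightarrow> real" where
  "symbol_frequency n K s =
     (\<Sum>x\<in>K. real (card {i\<in>{1..n}. x i = s})) / (real n * real (card K))"

definition equiprobable_inputs :: "(nat \<Rightarrow> (nat \<Rightarrow> nat) set) \<Rightarrow> bool" where
  "equiprobable_inputs K \<longleftrightarrow>
     (\<forall>s\<in>{1,2}. (\<lambda>n. symbol_frequency n (K n) s) \<longlonglongrightarrow> 1/2)"

definition achievable :: "nat \<Rightarrow> (nat \<Rightarrow> nat \<Rightarrow> real) \<Rightarrow> (nat \<Rightarrow> nat \<Rightarrow> real) \<Rightarrow> real \<Rightarrow> bool" where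
  "achievable m p q R \<longleftrightarrow> (\<exists>K. equiprobable_inputs K \<and> achieves m p q K R)"

definition max_achievable_rate ::
  "nat \<Rightarrow> (nat \<Rightarrow> nat \<Rightarrow> real) \<Rightarrow> (nat \<Rightarrow> nat \<Rightarrow> real) \<Rightarrow> ereal" where
  "max_achievable_rate m p q = (SUP R\<in>{R. achievable m p q R}. ereal R)"

text \<open>
  In the second branch every logarithm of \<open>0\<close> has coefficient \<open>0\<close>, so the
  convention \<open>0 * log 0 = 0\<close> holds.
\<close>

definition mismatch_rate ::
  "nat \<Rightarrow> (nat \<Rightarrow> nat \<Rightarrow> real) \<Rightarrow> (nat \<Rightarrow> nat \<Rightarrow> real) \<Rightarrow> ereal" where
  "mismatch_rate m p q =
     (if \<exists>i\<in>{1,2}. \<exists>j\<in>{1..m}. p i j > 0 \<and> q i j = 0 then - \<infinity>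
      else ereal (1/2 * (\<Sum>j=1..m. p 1 j * log 2 (q 1 j) + p 2 j * log 2 (q 2 j)
                            - (p 1 j + p 2 j) * log 2 ((q 1 j + q 2 j) / 2))))"

end

theory Submission imports Defs "HOL-Real_Asymp.Real_Asymp"
begin

text \<open>
  The codes come from a deterministic exchange argument instead of random coding. By Chebyshev's
  inequality most words \<open>x\<close> are balanced up to \<open>sqrt n\<close>, and for each balanced
  \<open>x\<close> the ratio of \<open>\<Prod>i. q (x i) (y i)\<close> to \<open>\<Prod>i. (q 1 (y i) + q 2 (y i)) / 2\<close>
  is at least \<open>2 powr (n * (C - \<delta>))\<close> with high probability. By Markov's inequality, for such
  \<open>y\<close> at most a fraction \<open>2 powr (- n * (C - \<delta>))\<close> of all words has a metric as large
  as that of \<open>x\<close>. So in the matrix of pairwise confusion probabilities every row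
  has a small sum, and a set of \<open>2 powr (n * R)\<close> balanced words that minimises the total
  internal confusion has small error probability at each of its words, however ties are broken.
\<close>

section \<open>Second moments and Chebyshev's inequality for product distributions\<close>

text \<open>Independent centred summands are uncorrelated. Expanding the square gives a double sum
  over \<open>i\<close>, \<open>j\<close>; for \<open>j \<noteq> i\<close> the sum over all
  \<open>y\<close> factorises into one-coordinate sums, of which the one at \<open>i\<close> is a
  mean and vanishes. Only the diagonal survives.\<close>

lemma product_second_moment:
  fixes w g :: "'i \<Rightarrow> 'a \<Rightarrow> real"
  assumes I: "finite I" and T: "finite T"
    and mass: "\<And>i. i \<in> I \<Longrightarrow> (\<Sum>t\<in>T. w i t) = 1"
    and mean: "\<And>i. i \<in> I \<Longrightarrow> (\<Sum>t\<in>T. w i t * g i t) = 0"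
  shows "(\<Sum>y\<in>I \<rightarrow>\<^sub>E T. (\<Prod>i\<in>I. w i (y i)) * (\<Sum>i\<in>I. g i (y i))\<^sup>2)
    = (\<Sum>i\<in>I. \<Sum>t\<in>T. w i t * (g i t)\<^sup>2)"
proof -
  \<comment> \<open>\<open>u i j k\<close> is the weight of coordinate \<open>k\<close> multiplied
    by those of the factors \<open>g i\<close>, \<open>g j\<close> that live there, so that each
    term of the expanded square becomes a pure product over \<open>k\<close>. For
    \<open>i = j\<close> both factors land on the same coordinate and give the square.\<close>
  define u where "u i j k t = w k t * (if k = i then g i t else 1) * (if k = j then g j t else 1)"
    for i j k t
  have u_prod: "(\<Prod>k\<in>I. u i j k (y k)) = (\<Prod>k\<in>I. w k (y k)) * (g i (y i) * g j (y j))"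
    if "i \<in> I" "j \<in> I" for i j y
    using that I by (simp add: u_def prod.distrib prod.delta)
  have u_other: "(\<Sum>t\<in>T. u i j k t) = 1" if "k \<in> I" "k \<noteq> i" "k \<noteq> j" for i j k
    using that mass by (simp add: u_def)
  have cross: "(\<Prod>k\<in>I. \<Sum>t\<in>T. u i j k t) = (if j = i then \<Sum>t\<in>T. w i t * (g i t)\<^sup>2 else 0)"
    if "i \<in> I" "j \<in> I" for i j
  proof (cases "j = i")
    case True
    have "(\<Prod>k\<in>I. \<Sum>t\<in>T. u i j k t)
        = (\<Sum>t\<in>T. u i j i t) * (\<Prod>k\<in>I - {i}. \<Sum>t\<in>T. u i j k t)"
      using that I by (simp add: prod.remove)
    also have "(\<Prod>k\<in>I - {i}. \<Sum>t\<in>T. u i j k t) = 1"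
      using True u_other by (intro prod.neutral) auto
    finally show ?thesis
      using True by (simp add: u_def power2_eq_square mult.assoc)
  next
    case False
    have "(\<Sum>t\<in>T. u i j i t) = 0"
      using False mean[OF that(1)] by (simp add: u_def)
    then show ?thesis
      using False that I by (auto intro: prod_zero)
  qed
  have "(\<Sum>y\<in>I \<rightarrow>\<^sub>E T. (\<Prod>i\<in>I. w i (y i)) * (\<Sum>i\<in>I. g i (y i))\<^sup>2)
      = (\<Sum>y\<in>I \<rightarrow>\<^sub>E T. \<Sum>i\<in>I. \<Sum>j\<in>I. \<Prod>k\<in>I. u i j k (y k))"
    by (intro sum.cong refl)
      (simp add: u_prod power2_eq_square sum_product, simp add: sum_distrib_left)
  also have "\<dots> = (\<Sum>i\<in>I. \<Sum>y\<in>I \<rightarrow>\<^sub>E T. \<Sum>j\<in>I. \<Prod>k\<in>I. u i j k (y k))"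
    by (rule sum.swap)
  also have "\<dots> = (\<Sum>i\<in>I. \<Sum>j\<in>I. \<Sum>y\<in>I \<rightarrow>\<^sub>E T. \<Prod>k\<in>I. u i j k (y k))"
    by (intro sum.cong refl sum.swap)
  also have "\<dots> = (\<Sum>i\<in>I. \<Sum>j\<in>I. \<Prod>k\<in>I. \<Sum>t\<in>T. u i j k t)"
    using I T by (simp add: prod_sum_PiE)
  also have "\<dots> = (\<Sum>i\<in>I. \<Sum>t\<in>T. w i t * (g i t)\<^sup>2)"
    using I by (simp add: cross cong: sum.cong)
  finally show ?thesis .
qed

text \<open>On the event of summation the squared sum is at least \<open>a\<^sup>2\<close>, while
  its total expectation is the sum of the variances.\<close>

lemma product_chebyshev:
  fixes w g :: "'i \<Rightarrow> 'a \<Rightarrow> real"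
  assumes I: "finite I" and T: "finite T"
    and nonneg: "\<And>i t. i \<in> I \<Longrightarrow> t \<in> T \<Longrightarrow> 0 \<le> w i t"
    and mass: "\<And>i. i \<in> I \<Longrightarrow> (\<Sum>t\<in>T. w i t) = 1"
    and mean: "\<And>i. i \<in> I \<Longrightarrow> (\<Sum>t\<in>T. w i t * g i t) = 0"
    and var: "\<And>i. i \<in> I \<Longrightarrow> (\<Sum>t\<in>T. w i t * (g i t)\<^sup>2) \<le> V"
    and a: "0 < a"
  shows "(\<Sum>y | y \<in> I \<rightarrow>\<^sub>E T \<and> a \<le> \<bar>\<Sum>i\<in>I. g i (y i)\<bar>. \<Prod>i\<in>I. w i (y i))
    \<le> real (card I) * V / a\<^sup>2"
proof -
  let ?S = "{y. y \<in> I \<rightarrow>\<^sub>E T \<and> a \<le> \<bar>\<Sum>i\<in>I. g i (y i)\<bar>}"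
  have fin: "finite (I \<rightarrow>\<^sub>E T)" using I T by (simp add: finite_PiE)
  have w0: "0 \<le> (\<Prod>i\<in>I. w i (y i))" if "y \<in> I \<rightarrow>\<^sub>E T" for y
    using that nonneg by (intro prod_nonneg) (auto simp: PiE_iff)
  have "a\<^sup>2 * (\<Sum>y\<in>?S. \<Prod>i\<in>I. w i (y i))
      = (\<Sum>y\<in>?S. (\<Prod>i\<in>I. w i (y i)) * a\<^sup>2)"
    by (simp add: sum_distrib_left mult.commute)
  also have "\<dots> \<le> (\<Sum>y\<in>?S. (\<Prod>i\<in>I. w i (y i)) * (\<Sum>i\<in>I. g i (y i))\<^sup>2)"
    using w0 a by (intro sum_mono mult_left_mono) (auto simp: abs_le_square_iff[symmetric])
  also have "\<dots> \<le> (\<Sum>y\<in>I \<rightarrow>\<^sub>E T. (\<Prod>i\<in>I. w i (y i)) * (\<Sum>i\<in>I. g i (y i))\<^sup>2)"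
    using w0 fin by (intro sum_mono2) auto
  also have "\<dots> = (\<Sum>i\<in>I. \<Sum>t\<in>T. w i t * (g i t)\<^sup>2)"
    by (rule product_second_moment[OF I T mass mean])
  also have "\<dots> \<le> real (card I) * V"
    using var by (intro sum_bounded_above) auto
  finally show ?thesis
    using a by (simp add: pos_le_divide_eq mult.commute)
qed

section \<open>Union bound and subsets of small internal weight\<close>

lemma sum_UN_le:
  fixes f :: "'a \<Rightarrow> real"
  assumes "finite I" "\<And>i. i \<in> I \<Longrightarrow> finite (A i)"
    and "\<And>i a. i \<in> I \<Longrightarrow> a \<in> A i \<Longrightarrow> 0 \<le> f a"
  shows "sum f (\<Union>i\<in>I. A i) \<le> (\<Sum>i\<in>I. sum f (A i))"
  using assms
proof (induction I rule: finite_induct)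
  case (insert i I)
  have "sum f (A i \<union> (\<Union>i\<in>I. A i)) \<le> sum f (A i) + sum f (\<Union>i\<in>I. A i)"
    using insert by (subst sum_Un) (auto intro!: sum_nonneg)
  with insert show ?case by force
qed simp

text \<open>
  A subset of minimal internal weight: exchanging an element \<open>x\<close> of \<open>K\<close> for an
  outside element \<open>z\<close> cannot decrease the weight, so the weight between \<open>x\<close> and the
  rest of \<open>K\<close> is at most its average over all such \<open>z\<close>.
\<close>

lemma sparse_subset_symmetric:
  fixes s :: "'a \<Rightarrow> 'a \<Rightarrow> real"
  assumes A: "finite A" and sym: "\<And>x z. s x z = s z x"
    and nonneg: "\<And>x z. x \<in> A \<Longrightarrow> z \<in> A \<Longrightarrow> 0 \<le> s x z"
    and degree: "\<And>x. x \<in> A \<Longrightarrow> (\<Sum>z\<in>A. s x z) \<le> D"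
    and M: "M \<le> card A"
  obtains K where "K \<subseteq> A" "card K = M"
    "\<And>x. x \<in> K \<Longrightarrow> (real (card A) - real M) * (\<Sum>z\<in>K - {x}. s x z) \<le> real M * D"
proof -
  define W where "W K = (\<Sum>x\<in>K. \<Sum>z\<in>K - {x}. s x z)" for K
  let ?F = "{K. K \<subseteq> A \<and> card K = M}"
  have "finite ?F" using A by simp
  moreover have "?F \<noteq> {}"
    using obtain_subset_with_card_n[OF M] by blast
  ultimately obtain K where K: "K \<in> ?F" and min: "\<And>K'. K' \<in> ?F \<Longrightarrow> W K \<le> W K'"
    using arg_min_if_finite[of ?F W] by (metis (no_types, lifting) not_less)
  have finK: "finite K" using K A finite_subset by blast
  \<comment> \<open>\<open>W\<close> counts ordered pairs, so by symmetry each new edge is counted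
    twice.\<close>
  have W_insert: "W (insert x L) = W L + 2 * (\<Sum>z\<in>L. s x z)" if "finite L" "x \<notin> L" for x L
  proof -
    have "(\<Sum>y\<in>L. \<Sum>z\<in>insert x L - {y}. s y z) = (\<Sum>y\<in>L. s y x + (\<Sum>z\<in>L - {y}. s y z))"
      using that by (intro sum.cong refl) (auto simp: insert_Diff_if)
    moreover have "insert x L - {x} = L" using that by auto
    ultimately show ?thesis
      using that sym by (simp add: W_def sum.distrib)
  qed
  have "(real (card A) - real M) * (\<Sum>z\<in>K - {x}. s x z) \<le> real M * D" if x: "x \<in> K" for x
  proof -
    let ?L = "K - {x}"
    have swap: "(\<Sum>y\<in>?L. s x y) \<le> (\<Sum>y\<in>?L. s z y)" if z: "z \<in> A - K" for z
    proof -
      have "card (insert z ?L) = M"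
        using z K finK card_Suc_Diff1[OF finK x] by simp
      then have "W K \<le> W (insert z ?L)"
        using z K by (intro min) auto
      moreover have "W K = W ?L + 2 * (\<Sum>y\<in>?L. s x y)"
        using W_insert[of ?L x] x finK by (simp add: insert_absorb)
      moreover have "W (insert z ?L) = W ?L + 2 * (\<Sum>y\<in>?L. s z y)"
        using W_insert[of ?L z] z finK by simp
      ultimately show ?thesis by simp
    qed
    \<comment> \<open>Needed below to enlarge the factor \<open>card (K - {x})\<close>, which is
      \<open>M - 1\<close>, to \<open>M\<close>.\<close>
    have D0: "0 \<le> D"
      using degree[of x] x K sum_nonneg[of A "s x"] nonneg by force
    have "real (card (A - K)) * (\<Sum>y\<in>?L. s x y) \<le> (\<Sum>z\<in>A - K. \<Sum>y\<in>?L. s z y)"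
      using swap by (intro sum_bounded_below) auto
    also have "\<dots> = (\<Sum>y\<in>?L. \<Sum>z\<in>A - K. s y z)"
      by (subst sum.swap) (simp add: sym)
    also have "\<dots> \<le> (\<Sum>y\<in>?L. \<Sum>z\<in>A. s y z)"
      using A K nonneg by (intro sum_mono sum_mono2) auto
    also have "\<dots> \<le> real (card ?L) * D"
      using K degree by (intro sum_bounded_above) auto
    also have "\<dots> \<le> real M * D"
      using K D0 finK by (intro mult_right_mono) (auto intro: card_mono)
    finally show ?thesis
      using K A M finK by (simp add: card_Diff_subset of_nat_diff)
  qed
  with K that show ?thesis by blast
qed

text \<open>The exchange argument needs symmetric weights, whereas a confusion matrix is not
  symmetric and only its row sums are controlled. Hence heavy columns are dropped first and
  \<open>w x z + w z x\<close> is used on what remains.\<close>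

lemma sparse_subset:
  fixes w :: "'a \<Rightarrow> 'a \<Rightarrow> real"
  assumes A: "finite A" "A \<noteq> {}" and nonneg: "\<And>x z. x \<in> A \<Longrightarrow> z \<in> A \<Longrightarrow> 0 \<le> w x z"
    and row: "\<And>x. x \<in> A \<Longrightarrow> (\<Sum>z\<in>A. w x z) \<le> B" and B: "0 < B"
    and M: "4 * M \<le> card A"
  obtains K where "K \<subseteq> A" "card K = M"
    "\<And>x. x \<in> K \<Longrightarrow> (\<Sum>z\<in>K - {x}. w x z) \<le> 12 * real M * B / real (card A)"
proof -
  \<comment> \<open>Without the columns of large sum, the symmetrised weights have bounded degrees.\<close>
  define A' where "A' = {z \<in> A. (\<Sum>x\<in>A. w x z) \<le> 2 * B}"
  have A': "finite A'" "A' \<subseteq> A" using A by (auto simp: A'_def)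
  \<comment> \<open>Markov's inequality over the columns: the total weight is at most
    \<open>card A * B\<close>, so at most half of the columns exceed \<open>2 * B\<close>.\<close>
  have "real (card (A - A')) * (2 * B) \<le> (\<Sum>z\<in>A - A'. \<Sum>x\<in>A. w x z)"
    by (intro sum_bounded_below) (auto simp: A'_def)
  also have "\<dots> \<le> (\<Sum>z\<in>A. \<Sum>x\<in>A. w x z)"
    using A nonneg by (intro sum_mono2 sum_nonneg) auto
  also have "\<dots> = (\<Sum>x\<in>A. \<Sum>z\<in>A. w x z)" by (rule sum.swap)
  also have "\<dots> \<le> real (card A) * B" using row by (intro sum_bounded_above) auto
  finally have "2 * real (card (A - A')) \<le> real (card A)" using B by simp
  then have half: "real (card A) \<le> 2 * real (card A')"
    using A A' card_mono[of A A'] by (simp add: card_Diff_subset of_nat_diff)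
  have "(\<Sum>z\<in>A'. w x z + w z x) \<le> 3 * B" if "x \<in> A'" for x
  proof -
    have "(\<Sum>z\<in>A'. w x z) \<le> (\<Sum>z\<in>A. w x z)" "(\<Sum>z\<in>A'. w z x) \<le> (\<Sum>z\<in>A. w z x)"
      using that A A' nonneg by (auto intro!: sum_mono2)
    moreover have "(\<Sum>z\<in>A. w x z) \<le> B" "(\<Sum>z\<in>A. w z x) \<le> 2 * B"
      using that row by (auto simp: A'_def)
    ultimately show ?thesis by (simp add: sum.distrib)
  qed
  moreover have "M \<le> card A'" using half M by linarith
  moreover have "0 \<le> w x z + w z x" if "x \<in> A'" "z \<in> A'" for x z
    using that nonneg A' by (intro add_nonneg_nonneg) auto
  ultimately obtain K where K: "K \<subseteq> A'" "card K = M"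
    and sparse: "\<And>x. x \<in> K \<Longrightarrow>
      (real (card A') - real M) * (\<Sum>z\<in>K - {x}. w x z + w z x) \<le> real M * (3 * B)"
    using sparse_subset_symmetric[of A' "\<lambda>x z. w x z + w z x" "3 * B" M, OF A'(1) add.commute]
    by blast
  have "(\<Sum>z\<in>K - {x}. w x z) \<le> 12 * real M * B / real (card A)" if "x \<in> K" for x
  proof -
    have cA: "0 < real (card A)" using A by (simp add: card_gt_0_iff)
    \<comment> \<open>\<open>card A'\<close> is at least half of \<open>card A\<close> and
      \<open>M\<close> at most a quarter, which leaves a quarter; together with the degree bound
      \<open>3 * B\<close> this yields the constant 12.\<close>
    have "real (card A) / 4 * (\<Sum>z\<in>K - {x}. w x z)
        \<le> (real (card A') - real M) * (\<Sum>z\<in>K - {x}. w x z + w z x)"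
      using half M nonneg that K A' by (intro mult_mono sum_mono sum_nonneg add_nonneg_nonneg) auto
    also have "\<dots> \<le> real M * (3 * B)" using that by (rule sparse)
    finally show ?thesis using cA by (simp add: field_simps)
  qed
  with K A' that show ?thesis by blast
qed

section \<open>Balanced words\<close>

text \<open>The number of ones minus \<open>n / 2\<close>, written as a sum of letter contributions
  that under uniform letters have mean 0 and variance 1/4, ready for
  \<open>product_chebyshev\<close>.\<close>

definition imbalance :: "nat \<Rightarrow> (nat \<Rightarrow> nat) \<Rightarrow> real" where
  "imbalance n x = (\<Sum>i=1..n. if x i = 1 then 1/2 else - 1/2)"

text \<open>The width \<open>sqrt n\<close> is two standard deviations of the imbalance, so at most
  a quarter of all words is excluded; it is also of smaller order than \<open>n\<close>, so symbol
  frequencies still tend to 1/2.\<close>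

definition balanced_words :: "nat \<Rightarrow> (nat \<Rightarrow> nat) set" where
  "balanced_words n = {x \<in> input_words n. \<bar>imbalance n x\<bar> \<le> sqrt (real n)}"

lemma finite_input_words: "finite (input_words n)"
  by (simp add: finite_PiE)

lemma finite_output_words: "finite (output_words m n)"
  by (simp add: finite_PiE)

lemma card_input_words: "card (input_words n) = 2 ^ n"
  by (simp add: card_PiE numeral_2_eq_2)

lemma finite_balanced_words: "finite (balanced_words n)"
  using finite_input_words by (simp add: balanced_words_def)

lemma card_balanced_words: "3/4 * 2 ^ n \<le> real (card (balanced_words n))"
proof (cases "n = 0")
  \<comment> \<open>Separate because the Chebyshev threshold \<open>sqrt n\<close> must be
    positive.\<close>
  case True
  then have "balanced_words n = input_words n"
    by (auto simp: balanced_words_def imbalance_def)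
  then show ?thesis using card_input_words[of n] True by simp
next
  case False
  let ?U = "{x. x \<in> input_words n \<and> sqrt (real n) \<le> \<bar>imbalance n x\<bar>}"
  have fin: "finite ?U" using finite_input_words[of n] by simp
  have "(\<Sum>x\<in>?U. \<Prod>i\<in>{1..n}. 1/2 :: real)
      \<le> real (card {1..n}) * (1/4) / (sqrt (real n))\<^sup>2"
    unfolding imbalance_def using False
    by (intro product_chebyshev[where w = "\<lambda>_ _. 1/2" and g = "\<lambda>_ t. if t = 1 then 1/2 else - 1/2"])
      (auto simp: power2_eq_square)
  then have U: "real (card ?U) \<le> 2 ^ n / 4"
    using False by (simp add: power_divide field_simps)
  have "card (input_words n) \<le> card (balanced_words n \<union> ?U)"
    using fin finite_balanced_words by (intro card_mono) (auto simp: balanced_words_def)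
  also have "\<dots> \<le> card (balanced_words n) + card ?U" by (rule card_Un_le)
  finally have "real (2 ^ n) \<le> real (card (balanced_words n) + card ?U)"
    unfolding card_input_words by (rule of_nat_mono)
  with U show ?thesis by simp
qed

lemma symbol_count:
  assumes "x \<in> input_words n" "s \<in> {1, 2}"
  shows "real (card {i \<in> {1..n}. x i = s})
    = real n / 2 + (if s = 1 then imbalance n x else - imbalance n x)"
proof -
  have "real (card {i \<in> {1..n}. x i = s}) = (\<Sum>i=1..n. if x i = s then 1 else 0)"
    by (simp add: sum.If_cases Int_def)
  also have "\<dots> = (\<Sum>i=1..n. 1/2 + (if s = 1 then 1 else - 1) * (if x i = 1 then 1/2 else - 1/2))"
    using assms by (intro sum.cong refl) (auto simp: PiE_iff)
  also have "\<dots> = real n / 2 + (if s = 1 then imbalance n x else - imbalance n x)"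
    by (simp add: imbalance_def sum.distrib sum_distrib_left[symmetric])
  finally show ?thesis .
qed

text \<open>Each codeword misses \<open>n / 2\<close> occurrences by at most \<open>sqrt n\<close>,
  and averaging over the code cannot increase the largest deviation.\<close>

lemma symbol_frequency_balanced:
  assumes K: "K \<subseteq> balanced_words n" "K \<noteq> {}" and s: "s \<in> {1, 2}" and n: "0 < n"
  shows "\<bar>symbol_frequency n K s - 1/2\<bar> \<le> 1 / sqrt (real n)"
proof -
  have cK: "0 < real (card K)"
    using K finite_balanced_words[of n] by (simp add: card_gt_0_iff finite_subset)
  have "\<bar>(\<Sum>x\<in>K. real (card {i\<in>{1..n}. x i = s})) - real (card K) * (real n / 2)\<bar>
      = \<bar>\<Sum>x\<in>K. real (card {i\<in>{1..n}. x i = s}) - real n / 2\<bar>"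
    by (simp add: sum_subtractf)
  also have "\<dots> \<le> (\<Sum>x\<in>K. \<bar>real (card {i\<in>{1..n}. x i = s}) - real n / 2\<bar>)"
    by (rule sum_abs)
  also have "\<dots> \<le> real (card K) * sqrt (real n)"
  proof (rule sum_bounded_above)
    fix x assume "x \<in> K"
    with K have "x \<in> input_words n" "\<bar>imbalance n x\<bar> \<le> sqrt (real n)"
      by (auto simp: balanced_words_def)
    then show "\<bar>real (card {i\<in>{1..n}. x i = s}) - real n / 2\<bar> \<le> sqrt (real n)"
      using symbol_count[OF _ s] by auto
  qed
  finally have *: "\<bar>(\<Sum>x\<in>K. real (card {i\<in>{1..n}. x i = s})) - real (card K) * (real n / 2)\<bar>
      / (real n * real (card K)) \<le> real (card K) * sqrt (real n) / (real n * real (card K))"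
    by (rule divide_right_mono) simp
  have "\<bar>symbol_frequency n K s - 1/2\<bar>
      = \<bar>((\<Sum>x\<in>K. real (card {i\<in>{1..n}. x i = s})) - real (card K) * (real n / 2))
          / (real n * real (card K))\<bar>"
    using cK n by (simp add: symbol_frequency_def diff_divide_distrib)
  also have "\<dots> \<le> real (card K) * sqrt (real n) / (real n * real (card K))"
    using * by (simp add: abs_mult)
  also have "\<dots> = 1 / sqrt (real n)"
    using cK n by (simp add: real_div_sqrt divide_simps)
  finally show ?thesis .
qed

section \<open>Scores of letters and words, and competing words\<close>

text \<open>The case of a finite \<open>mismatch_rate\<close>: \<open>support\<close> negates the
  condition of its first branch.\<close>

locale mismatched_channel =
  fixes m :: nat and p q :: "nat \<Rightarrow> nat \<Rightarrow> real"
  assumes p: "transition_probs m p" and q: "transition_probs m q"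
    and support: "\<And>i j. i \<in> {1, 2} \<Longrightarrow> j \<in> {1..m} \<Longrightarrow> 0 < p i j \<Longrightarrow> q i j \<noteq> 0"
begin

text \<open>The information density of the estimated channel under uniform inputs. Where
  \<open>q i j = 0\<close> the logarithm has a default value, but there \<open>p i j = 0\<close> by
  \<open>support\<close>.\<close>

definition score :: "nat \<Rightarrow> nat \<Rightarrow> real" where
  "score i j = log 2 (q i j) - log 2 ((q 1 j + q 2 j) / 2)"

definition word_score :: "nat \<Rightarrow> (nat \<Rightarrow> nat) \<Rightarrow> (nat \<Rightarrow> nat) \<Rightarrow> real" where
  "word_score n x y = (\<Sum>i=1..n. score (x i) (y i))"

definition mean_score :: "nat \<Rightarrow> real" where
  "mean_score i = (\<Sum>j=1..m. p i j * score i j)"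

text \<open>The real number denoted C in the theorem, as the expected score for an equiprobable
  input letter.\<close>

definition capacity :: real where
  "capacity = (mean_score 1 + mean_score 2) / 2"

text \<open>Adding the variances for both letters gives one bound that serves for every position of
  every word.\<close>

definition score_variance :: real where
  "score_variance = (\<Sum>i\<in>{1,2}. \<Sum>j=1..m. p i j * (score i j - mean_score i)\<^sup>2)"

lemma p_nonneg: "i \<in> {1, 2} \<Longrightarrow> j \<in> {1..m} \<Longrightarrow> 0 \<le> p i j"
  and q_nonneg: "i \<in> {1, 2} \<Longrightarrow> j \<in> {1..m} \<Longrightarrow> 0 \<le> q i j"
  and p_sum: "i \<in> {1, 2} \<Longrightarrow> (\<Sum>j=1..m. p i j) = 1"
  using p q by (auto simp: transition_probs_def)

lemma word_prob_nonneg: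
  assumes "x \<in> input_words n" "y \<in> output_words m n"
  shows "0 \<le> word_prob p n x y" "0 \<le> word_prob q n x y"
  using assms by (auto simp: word_prob_def PiE_iff intro!: prod_nonneg p_nonneg q_nonneg)

lemma word_prob_sum:
  assumes "x \<in> input_words n"
  shows "(\<Sum>y\<in>output_words m n. word_prob p n x y) = 1"
proof -
  have "(\<Sum>y\<in>output_words m n. word_prob p n x y) = (\<Prod>i=1..n. \<Sum>j=1..m. p (x i) j)"
    unfolding word_prob_def by (rule prod_sum_PiE[symmetric]) auto
  also have "\<dots> = 1"
    using assms by (intro prod.neutral ballI p_sum) (auto simp: PiE_iff)
  finally show ?thesis .
qed

lemma mismatch_rate_eq: "mismatch_rate m p q = ereal capacity"
proof -
  have "\<not> (\<exists>i\<in>{1,2}. \<exists>j\<in>{1..m}. p i j > 0 \<and> q i j = 0)"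
    using support by blast
  moreover have "(\<Sum>j=1..m. p 1 j * log 2 (q 1 j) + p 2 j * log 2 (q 2 j)
      - (p 1 j + p 2 j) * log 2 ((q 1 j + q 2 j) / 2)) = mean_score 1 + mean_score 2"
    unfolding mean_score_def score_def sum.distrib[symmetric]
    by (intro sum.cong refl) (simp add: algebra_simps)
  ultimately show ?thesis
    unfolding mismatch_rate_def capacity_def by (simp only: if_False) simp
qed

lemma q_pos:
  assumes "i \<in> {1, 2}" "j \<in> {1..m}" "0 < p i j"
  shows "0 < q i j" "q i j \<le> q 1 j + q 2 j"
  using assms support[OF assms] q_nonneg[of 1 j] q_nonneg[of 2 j] by fastforce+

lemma q_eq_score:
  assumes "i \<in> {1, 2}" "j \<in> {1..m}" "0 < p i j"
  shows "q i j = (q 1 j + q 2 j) / 2 * 2 powr score i j"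
  using q_pos[OF assms] by (simp add: score_def powr_diff)

lemma score_le_1:
  assumes "i \<in> {1, 2}" "j \<in> {1..m}" "0 < p i j"
  shows "score i j \<le> 1"
proof -
  have "log 2 (q i j) \<le> log 2 (2 * ((q 1 j + q 2 j) / 2))"
    using q_pos[OF assms] by simp
  also have "\<dots> = 1 + log 2 ((q 1 j + q 2 j) / 2)"
    using q_pos[OF assms] by (subst log_mult) auto
  finally show ?thesis by (simp add: score_def)
qed

text \<open>A rate below \<open>capacity\<close> is therefore below 1, so
  \<open>2 powr (n * R)\<close> is a vanishing fraction of all words and
  \<open>sparse_subset\<close> has enough room. The bound holds since \<open>q i j\<close> is at
  most twice the average of \<open>q 1 j\<close> and \<open>q 2 j\<close>.\<close>

lemma capacity_le_1: "capacity \<le> 1"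
proof -
  have "mean_score i \<le> 1" if i: "i \<in> {1, 2}" for i
  proof -
    have "mean_score i \<le> (\<Sum>j=1..m. p i j * 1)"
      unfolding mean_score_def
    proof (rule sum_mono)
      fix j assume j: "j \<in> {1..m}"
      then show "p i j * score i j \<le> p i j * 1"
        using score_le_1[OF i j] p_nonneg[OF i j]
        by (cases "p i j = 0") (auto intro!: mult_left_mono)
    qed
    with p_sum[OF i] show ?thesis by simp
  qed
  from this[of 1] this[of 2] show ?thesis by (simp add: capacity_def)
qed

text \<open>
  A uniformly random input word \<open>x'\<close> has expected metric \<open>\<Prod>i. (q 1 (y i) + q 2 (y i)) / 2\<close>;
  Markov's inequality bounds the number of words beating \<open>x\<close>.
\<close>

lemma card_competitors:
  assumes x: "x \<in> input_words n" and y: "y \<in> output_words m n" and pos: "0 < word_prob p n x y"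
  shows "real (card {x' \<in> input_words n. word_prob q n x y \<le> word_prob q n x' y})
    \<le> 2 ^ n * 2 powr (- word_score n x y)"
proof -
  let ?S = "{x' \<in> input_words n. word_prob q n x y \<le> word_prob q n x' y}"
  let ?c = "\<Prod>i=1..n. (q 1 (y i) + q 2 (y i)) / 2"
  \<comment> \<open>A positive product has no zero factor, so \<open>y\<close> avoids all
    transitions at which \<open>score\<close> may be a default value.\<close>
  have pos_i: "0 < p (x i) (y i)" "x i \<in> {1, 2}" "y i \<in> {1..m}" if "i \<in> {1..n}" for i
  proof -
    show *: "x i \<in> {1, 2}" "y i \<in> {1..m}" using that x y by (auto simp: PiE_iff)
    have "word_prob p n x y = 0" if "p (x i) (y i) = 0"
      unfolding word_prob_def using that \<open>i \<in> {1..n}\<close> by (intro prod_zero) auto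
    with pos have "p (x i) (y i) \<noteq> 0" by auto
    with p_nonneg[OF *] show "0 < p (x i) (y i)" by simp
  qed
  \<comment> \<open>\<open>?c\<close> is the estimated likelihood of \<open>y\<close> under uniform
    inputs; relative to it the metric of \<open>x\<close> is \<open>2 powr word_score n x y\<close>,
    and \<open>?c\<close> cancels at the end.\<close>
  have "word_prob q n x y
      = (\<Prod>i=1..n. (q 1 (y i) + q 2 (y i)) / 2 * 2 powr score (x i) (y i))"
    unfolding word_prob_def using pos_i by (intro prod.cong refl q_eq_score) auto
  then have q_eq: "word_prob q n x y = ?c * 2 powr word_score n x y"
    by (simp only: prod.distrib word_score_def powr_sum[of 2, simplified])
  have c: "0 < ?c"
    using q_pos[OF pos_i(2,3,1)] by (intro prod_pos) force
  have "real (card ?S) * word_prob q n x y \<le> (\<Sum>x'\<in>?S. word_prob q n x' y)"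
    by (intro sum_bounded_below) auto
  also have "\<dots> \<le> (\<Sum>x'\<in>input_words n. word_prob q n x' y)"
    using word_prob_nonneg(2) y finite_input_words by (intro sum_mono2) auto
  also have "\<dots> = (\<Prod>i=1..n. \<Sum>s\<in>{1,2}. q s (y i))"
    unfolding word_prob_def by (rule prod_sum_PiE[symmetric]) auto
  also have "\<dots> = (\<Prod>i=1..n. 2 * ((q 1 (y i) + q 2 (y i)) / 2))"
    by (intro prod.cong refl) simp
  also have "\<dots> = 2 ^ n * ?c"
    by (simp only: prod.distrib) simp
  finally have "real (card ?S) * 2 powr word_score n x y * ?c \<le> 2 ^ n * ?c"
    by (simp only: q_eq mult_ac)
  with c show ?thesis
    by (simp add: powr_minus_divide pos_le_divide_eq del: prod_dividef)
qed

section \<open>Confusion weights and the error bound\<close>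

text \<open>Outputs of score at most \<open>t\<close> are left out here and handled by
  \<open>word_score_concentration\<close>. Ties count as confusion, which makes the bounds
  independent of how the decoder breaks them.\<close>

definition confusion :: "nat \<Rightarrow> real \<Rightarrow> (nat \<Rightarrow> nat) \<Rightarrow> (nat \<Rightarrow> nat) \<Rightarrow> real" where
  "confusion n t x x' = (\<Sum>y | y \<in> output_words m n \<and> t < word_score n x y \<and>
     word_prob q n x y \<le> word_prob q n x' y. word_prob p n x y)"

lemma confusion_nonneg: "x \<in> input_words n \<Longrightarrow> 0 \<le> confusion n t x x'"
  unfolding confusion_def by (intro sum_nonneg word_prob_nonneg) auto

text \<open>Summing over \<open>x'\<close> first counts the competitors of \<open>x\<close> at each
  output; by \<open>card_competitors\<close> there are at most \<open>2 ^ n * 2 powr (- t)\<close>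
  of them when the score exceeds \<open>t\<close>. The output probabilities add up to 1.\<close>

lemma confusion_sum:
  assumes x: "x \<in> input_words n"
  shows "(\<Sum>x'\<in>input_words n. confusion n t x x') \<le> 2 ^ n * 2 powr (- t)"
proof -
  let ?S = "\<lambda>y. {x' \<in> input_words n. word_prob q n x y \<le> word_prob q n x' y}"
  have "(\<Sum>x'\<in>input_words n. confusion n t x x')
      = (\<Sum>x'\<in>input_words n. \<Sum>y\<in>output_words m n. if t < word_score n x y \<and>
          word_prob q n x y \<le> word_prob q n x' y then word_prob p n x y else 0)"
    unfolding confusion_def using finite_output_words
    by (simp only: sum.inter_filter[symmetric])
  also have "\<dots> = (\<Sum>y\<in>output_words m n. \<Sum>x'\<in>input_words n. if t < word_score n x y \<and>
          word_prob q n x y \<le> word_prob q n x' y then word_prob p n x y else 0)"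
    by (rule sum.swap)
  also have "\<dots> \<le> (\<Sum>y\<in>output_words m n. word_prob p n x y * (2 ^ n * 2 powr (- t)))"
  proof (rule sum_mono)
    fix y assume y: "y \<in> output_words m n"
    show "(\<Sum>x'\<in>input_words n. if t < word_score n x y \<and>
        word_prob q n x y \<le> word_prob q n x' y then word_prob p n x y else 0)
        \<le> word_prob p n x y * (2 ^ n * 2 powr (- t))"
    \<comment> \<open>Outputs of probability 0 are split off because \<open>card_competitors\<close>
      requires positive probability; they contribute nothing.\<close>
    proof (cases "t < word_score n x y \<and> word_prob p n x y \<noteq> 0")
      case True
      then have pos: "0 < word_prob p n x y" using word_prob_nonneg(1)[OF x y] by simp
      have "(\<Sum>x'\<in>input_words n. if t < word_score n x y \<and>
          word_prob q n x y \<le> word_prob q n x' y then word_prob p n x y else 0)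
          = word_prob p n x y * real (card (?S y))"
        using True finite_input_words by (simp add: sum.inter_filter[symmetric] mult.commute)
      also have "\<dots> \<le> word_prob p n x y * (2 ^ n * 2 powr (- word_score n x y))"
        using card_competitors[OF x y pos] pos by (intro mult_left_mono) auto
      also have "\<dots> \<le> word_prob p n x y * (2 ^ n * 2 powr (- t))"
        using True pos by (intro mult_left_mono) auto
      finally show ?thesis .
    next
      case False
      then have "(\<Sum>x'\<in>input_words n. if t < word_score n x y \<and>
          word_prob q n x y \<le> word_prob q n x' y then word_prob p n x y else 0) = 0"
        by (intro sum.neutral) auto
      with word_prob_nonneg(1)[OF x y] show ?thesis by simp
    qed
  qed
  also have "\<dots> = 2 ^ n * 2 powr (- t)"
    by (simp add: sum_distrib_right[symmetric] word_prob_sum[OF x] del: One_nat_def)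
  finally show ?thesis .
qed

text \<open>Union bound: at an error either the score is low or the decoded word is itself a
  codeword other than \<open>x\<close> whose metric is at least that of \<open>x\<close>.\<close>

lemma error_prob_le:
  assumes K: "K \<subseteq> input_words n" and x: "x \<in> K" and d: "ml_decoder m q n K d"
  shows "error_prob m p n d x
    \<le> (\<Sum>y | y \<in> output_words m n \<and> word_score n x y \<le> t. word_prob p n x y)
      + (\<Sum>x'\<in>K - {x}. confusion n t x x')"
proof -
  let ?T = "{y. y \<in> output_words m n \<and> word_score n x y \<le> t}"
  let ?C = "\<lambda>x'. {y. y \<in> output_words m n \<and> t < word_score n x y \<and>
     word_prob q n x y \<le> word_prob q n x' y}"
  have xi: "x \<in> input_words n" using K x by auto
  have finK: "finite K" using K finite_input_words finite_subset by blast
  have fin: "finite ?T" "finite (?C x')" for x' using finite_output_words by simp_all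
  have nonneg: "0 \<le> word_prob p n x y" if "y \<in> output_words m n" for y
    using word_prob_nonneg(1)[OF xi that] .
  have "{y. y \<in> output_words m n \<and> d y \<noteq> x} \<subseteq> ?T \<union> (\<Union>x'\<in>K - {x}. ?C x')"
  proof
    fix y assume "y \<in> {y. y \<in> output_words m n \<and> d y \<noteq> x}"
    moreover from this have "d y \<in> K" "word_prob q n x y \<le> word_prob q n (d y) y"
      using d x by (auto simp: ml_decoder_def is_arg_max_linorder)
    ultimately show "y \<in> ?T \<union> (\<Union>x'\<in>K - {x}. ?C x')"
      by (cases "word_score n x y \<le> t") auto
  qed
  then have "error_prob m p n d x \<le> (\<Sum>y\<in>?T \<union> (\<Union>x'\<in>K - {x}. ?C x'). word_prob p n x y)"
    unfolding error_prob_def using fin finK nonneg by (intro sum_mono2) auto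
  also have "\<dots> \<le> (\<Sum>y\<in>?T. word_prob p n x y) + (\<Sum>y\<in>(\<Union>x'\<in>K - {x}. ?C x'). word_prob p n x y)"
    using fin finK nonneg by (subst sum_Un) (auto intro!: sum_nonneg)
  also have "(\<Sum>y\<in>(\<Union>x'\<in>K - {x}. ?C x'). word_prob p n x y)
      \<le> (\<Sum>x'\<in>K - {x}. confusion n t x x')"
    unfolding confusion_def using finK fin nonneg by (intro sum_UN_le) auto
  finally show ?thesis by simp
qed

text \<open>The expected score of \<open>x\<close> is \<open>n * capacity\<close> plus the imbalance
  times the difference of the mean scores. Balance keeps that correction within the
  \<open>sqrt n\<close> term of the threshold, so a score below it deviates from its mean by at
  least \<open>n * \<delta>\<close>, and Chebyshev's inequality applies.\<close>

lemma word_score_concentration: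
  assumes x: "x \<in> balanced_words n" and n: "0 < n" and \<delta>: "0 < \<delta>"
  shows "(\<Sum>y | y \<in> output_words m n \<and> word_score n x y
      \<le> real n * (capacity - \<delta>) - sqrt (real n) * \<bar>mean_score 1 - mean_score 2\<bar>. word_prob p n x y)
    \<le> score_variance / (real n * \<delta>\<^sup>2)"
proof -
  let ?D = "mean_score 1 - mean_score 2"
  let ?g = "\<lambda>i j. score (x i) j - mean_score (x i)"
  have xi: "x \<in> input_words n" and im: "\<bar>imbalance n x\<bar> \<le> sqrt (real n)"
    using x by (auto simp: balanced_words_def)
  have letter: "x i \<in> {1, 2}" if "i \<in> {1..n}" for i using xi that by (auto simp: PiE_iff)
  have "(\<Sum>i=1..n. mean_score (x i))
      = (\<Sum>i=1..n. capacity + ?D * (if x i = 1 then 1/2 else - 1/2))"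
  proof (intro sum.cong refl)
    fix i assume "i \<in> {1..n}"
    from letter[OF this] show "mean_score (x i) = capacity + ?D * (if x i = 1 then 1/2 else - 1/2)"
      by (auto simp: capacity_def field_simps)
  qed
  also have "\<dots> = real n * capacity + ?D * imbalance n x"
    by (simp add: imbalance_def sum.distrib sum_distrib_left)
  finally have mean: "(\<Sum>i=1..n. mean_score (x i)) = real n * capacity + ?D * imbalance n x" .
  have "\<bar>?D * imbalance n x\<bar> \<le> \<bar>?D\<bar> * sqrt (real n)"
    using im by (simp add: abs_mult mult_left_mono)
  then have lower: "real n * capacity - sqrt (real n) * \<bar>?D\<bar> \<le> (\<Sum>i=1..n. mean_score (x i))"
    unfolding mean by (simp add: mult.commute)
  have deviation: "real n * \<delta> \<le> \<bar>\<Sum>i=1..n. ?g i (y i)\<bar>"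
    if "word_score n x y \<le> real n * (capacity - \<delta>) - sqrt (real n) * \<bar>?D\<bar>" for y
  proof -
    have "(\<Sum>i=1..n. ?g i (y i)) = word_score n x y - (\<Sum>i=1..n. mean_score (x i))"
      by (simp add: sum_subtractf word_score_def)
    moreover have "real n * (capacity - \<delta>) = real n * capacity - real n * \<delta>"
      by (rule right_diff_distrib)
    ultimately show ?thesis using that lower by linarith
  qed
  have "(\<Sum>y | y \<in> output_words m n \<and> word_score n x y
      \<le> real n * (capacity - \<delta>) - sqrt (real n) * \<bar>?D\<bar>. word_prob p n x y)
    \<le> (\<Sum>y | y \<in> output_words m n \<and> real n * \<delta> \<le> \<bar>\<Sum>i=1..n. ?g i (y i)\<bar>. word_prob p n x y)"
  proof (rule sum_mono2)
    show "finite {y. y \<in> output_words m n \<and> real n * \<delta> \<le> \<bar>\<Sum>i=1..n. ?g i (y i)\<bar>}"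
      using finite_output_words by simp
    show "{y. y \<in> output_words m n \<and> word_score n x y
        \<le> real n * (capacity - \<delta>) - sqrt (real n) * \<bar>?D\<bar>}
      \<subseteq> {y. y \<in> output_words m n \<and> real n * \<delta> \<le> \<bar>\<Sum>i=1..n. ?g i (y i)\<bar>}"
      using deviation by blast
  qed (use word_prob_nonneg(1)[OF xi] in auto)
  also have "\<dots> \<le> real (card {1..n}) * score_variance / (real n * \<delta>)\<^sup>2"
    unfolding word_prob_def
  proof (rule product_chebyshev)
    fix i assume "i \<in> {1..n}"
    note xi = letter[OF this]
    show "(\<Sum>j=1..m. p (x i) j) = 1" using xi by (rule p_sum)
    then show "(\<Sum>j=1..m. p (x i) j * ?g i j) = 0"
      by (simp add: right_diff_distrib sum_subtractf mean_score_def sum_distrib_right[symmetric])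
    show "(\<Sum>j=1..m. p (x i) j * (?g i j)\<^sup>2) \<le> score_variance"
      unfolding score_variance_def
      using xi p_nonneg
      by (intro member_le_sum[of "x i" "{1,2}" "\<lambda>s. \<Sum>j=1..m. p s j * (score s j - mean_score s)\<^sup>2"]
          sum_nonneg mult_nonneg_nonneg) auto
  qed (use letter p_nonneg n \<delta> in auto)
  also have "\<dots> = score_variance / (real n * \<delta>\<^sup>2)"
    using n by (simp add: power2_eq_square)
  finally show ?thesis .
qed

section \<open>Good codes and achievable rates\<close>

lemma max_error_prob_nonneg:
  assumes "is_code n K"
  shows "0 \<le> max_error_prob m p n K d"
proof -
  have fin: "finite K" "K \<noteq> {}" "K \<subseteq> input_words n"
    using assms finite_input_words finite_subset by (auto simp: is_code_def)
  then obtain x where "x \<in> K" by blast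
  then have "0 \<le> error_prob m p n d x"
    unfolding error_prob_def using fin by (intro sum_nonneg word_prob_nonneg) auto
  with \<open>x \<in> K\<close> fin show ?thesis
    unfolding max_error_prob_def by (subst Max_ge_iff) auto
qed

text \<open>\<open>sparse_subset\<close> is applied to the confusion matrix of the balanced words,
  with the threshold of \<open>word_score_concentration\<close>, so both terms of
  \<open>error_prob_le\<close> are bounded at every codeword.\<close>

lemma balanced_code_exists:
  assumes n: "0 < n" and \<delta>: "0 < \<delta>" and M: "0 < M" "4 * real M \<le> 3/4 * 2 ^ n"
  shows "\<exists>K \<subseteq> balanced_words n. card K = M \<and> (\<forall>d. ml_decoder m q n K d \<longrightarrow>
    max_error_prob m p n K d \<le> score_variance / (real n * \<delta>\<^sup>2) + 16 * real M *
      2 powr (sqrt (real n) * \<bar>mean_score 1 - mean_score 2\<bar> - real n * (capacity - \<delta>)))"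
proof -
  let ?A = "balanced_words n"
  let ?t = "real n * (capacity - \<delta>) - sqrt (real n) * \<bar>mean_score 1 - mean_score 2\<bar>"
  let ?B = "2 ^ n * 2 powr (- ?t)"
  have A: "?A \<subseteq> input_words n" by (auto simp: balanced_words_def)
  have cA: "3/4 * 2 ^ n \<le> real (card ?A)" by (rule card_balanced_words)
  have cA0: "0 < real (card ?A)" using cA by (rule less_le_trans[rotated]) simp
  have row: "(\<Sum>z\<in>?A. confusion n ?t x z) \<le> ?B" if "x \<in> ?A" for x
  proof -
    have "x \<in> input_words n" using that A by auto
    then have "(\<Sum>z\<in>?A. confusion n ?t x z) \<le> (\<Sum>z\<in>input_words n. confusion n ?t x z)"
      using A finite_input_words confusion_nonneg by (intro sum_mono2) auto
    also have "\<dots> \<le> ?B" using \<open>x \<in> input_words n\<close> by (rule confusion_sum)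
    finally show ?thesis .
  qed
  have nonempty: "?A \<noteq> {}" using cA0 by auto
  have nonneg: "0 \<le> confusion n ?t x z" if "x \<in> ?A" for x z
    using that A confusion_nonneg by blast
  have M4: "4 * M \<le> card ?A" using M(2) cA by linarith
  obtain K where K: "K \<subseteq> ?A" "card K = M"
    and sparse: "\<And>x. x \<in> K \<Longrightarrow>
      (\<Sum>z\<in>K - {x}. confusion n ?t x z) \<le> 12 * real M * ?B / real (card ?A)"
    using sparse_subset[of ?A "confusion n ?t" ?B M, OF finite_balanced_words nonempty nonneg row _ M4]
    by auto
  \<comment> \<open>Balanced words make up at least 3/4 of all words, which turns 12 into 16 and
    cancels \<open>2 ^ n\<close>.\<close>
  have "12 * real M * ?B / real (card ?A) \<le> 12 * real M * ?B / (3/4 * 2 ^ n)"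
    using cA cA0 by (intro divide_left_mono) auto
  also have "\<dots> = 16 * real M * 2 powr (- ?t)" by simp
  finally have small: "12 * real M * ?B / real (card ?A) \<le> 16 * real M * 2 powr (- ?t)" .
  have "max_error_prob m p n K d
      \<le> score_variance / (real n * \<delta>\<^sup>2) + 16 * real M * 2 powr (- ?t)"
    if d: "ml_decoder m q n K d" for d
  proof -
    have "error_prob m p n d x
      \<le> score_variance / (real n * \<delta>\<^sup>2) + 16 * real M * 2 powr (- ?t)" if x: "x \<in> K" for x
    proof -
      have "x \<in> ?A" "K \<subseteq> input_words n" using x K A by auto
      with error_prob_le[OF this(2) x d, of ?t] word_score_concentration[OF this(1) n \<delta>]
        sparse[OF x] small
      show ?thesis by linarith
    qed
    moreover have "finite K" "K \<noteq> {}" using K M(1) by (auto intro: card_ge_0_finite)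
    ultimately show ?thesis unfolding max_error_prob_def by simp
  qed
  with K show ?thesis by (intro exI[of _ K]) simp
qed

text \<open>Turns existence of codes at all large lengths into a single sequence of codes, as
  \<open>achievable\<close> demands.\<close>

lemma achievableI:
  assumes R: "0 \<le> R" and b: "b \<longlonglongrightarrow> 0"
    and codes: "\<forall>\<^sub>F n in sequentially. \<exists>K \<subseteq> balanced_words n. card K = 2 ^ nat \<lfloor>real n * R\<rfloor> \<and>
      (\<forall>d. ml_decoder m q n K d \<longrightarrow> max_error_prob m p n K d \<le> b n)"
  shows "achievable m p q R"
proof -
  define good where "good n K \<longleftrightarrow> K \<subseteq> balanced_words n \<and> card K = 2 ^ nat \<lfloor>real n * R\<rfloor> \<and>
      (\<forall>d. ml_decoder m q n K d \<longrightarrow> max_error_prob m p n K d \<le> b n)" for n K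
  \<comment> \<open>The full set of words is only a nonempty filler where no good code exists; this
    concerns finitely many lengths and affects no limit.\<close>
  define K where "K n = (if \<exists>L. good n L then SOME L. good n L else input_words n)" for n
  have K_good: "\<forall>\<^sub>F n in sequentially. good n (K n)"
    using codes by eventually_elim (auto simp: K_def good_def[symmetric] intro: someI_ex)
  have good_nonempty: "L \<noteq> {}" if "good n L" for n L
    using that by (auto simp: good_def)
  have code: "is_code n (K n)" for n
  proof (cases "\<exists>L. good n L")
    case True
    then have "good n (K n)" by (simp add: K_def someI_ex)
    with good_nonempty show ?thesis
      by (auto simp: is_code_def good_def balanced_words_def)
  next
    case False
    then show ?thesis by (auto simp: K_def is_code_def PiE_eq_empty_iff)
  qed
  have "(\<lambda>n. rate n (K n)) \<longlonglongrightarrow> R"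
  proof (rule tendsto_sandwich)
    \<comment> \<open>The size is a power of 2, so the logarithm is exactly the floor, and rounding
      costs at most \<open>1 / n\<close> of rate.\<close>
    have *: "rate n (K n) = real_of_int \<lfloor>real n * R\<rfloor> / real n" if "good n (K n)" for n
      using that R by (simp add: rate_def good_def log_nat_power)
    show "\<forall>\<^sub>F n in sequentially. R - 1 / real n \<le> rate n (K n)"
      using K_good eventually_gt_at_top[of 0]
    proof eventually_elim
      case (elim n)
      then have "R - 1 / real n = (real n * R - 1) / real n" by (simp add: field_simps)
      also have "\<dots> \<le> real_of_int \<lfloor>real n * R\<rfloor> / real n"
        by (intro divide_right_mono) linarith+
      finally show ?case using *[OF elim(1)] by simp
    qed
    show "\<forall>\<^sub>F n in sequentially. rate n (K n) \<le> R"
      using K_good eventually_gt_at_top[of 0]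
    proof eventually_elim
      case (elim n)
      have "real_of_int \<lfloor>real n * R\<rfloor> / real n \<le> (real n * R) / real n"
        by (intro divide_right_mono) linarith+
      then show ?case using *[OF elim(1)] elim(2) by simp
    qed
    show "(\<lambda>n. R - 1 / real n) \<longlonglongrightarrow> R" by real_asymp
  qed auto
  moreover have "(\<lambda>n. max_error_prob m p n (K n) (d n)) \<longlonglongrightarrow> 0"
    if "\<forall>n. ml_decoder m q n (K n) (d n)" for d
  proof (rule tendsto_sandwich[OF _ _ tendsto_const b])
    show "\<forall>\<^sub>F n in sequentially. 0 \<le> max_error_prob m p n (K n) (d n)"
      using max_error_prob_nonneg[OF code] by simp
    show "\<forall>\<^sub>F n in sequentially. max_error_prob m p n (K n) (d n) \<le> b n"
      using K_good by eventually_elim (use that in \<open>auto simp: good_def\<close>)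
  qed
  moreover have "(\<lambda>n. symbol_frequency n (K n) s) \<longlonglongrightarrow> 1/2" if s: "s \<in> {1, 2}" for s
  proof (rule LIM_zero_cancel, rule tendsto_0_le)
    show "\<forall>\<^sub>F n in sequentially.
        norm (symbol_frequency n (K n) s - 1/2) \<le> norm (1 / sqrt (real n)) * 1"
      using K_good eventually_gt_at_top[of 0]
    proof eventually_elim
      case (elim n)
      then have "K n \<subseteq> balanced_words n" "K n \<noteq> {}" "0 < n"
        using good_nonempty by (auto simp: good_def)
      then show ?case using symbol_frequency_balanced[of "K n" n s] s by simp
    qed
    show "(\<lambda>n. 1 / sqrt (real n)) \<longlonglongrightarrow> 0" by real_asymp
  qed
  ultimately show ?thesis
    unfolding achievable_def achieves_def equiprobable_inputs_def using code by blast
qed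

text \<open>With a single codeword the arg max is forced and no error occurs. This puts the supremum
  of the achievable rates at 0 or above.\<close>

lemma achievable_0: "achievable m p q 0"
proof (rule achievableI[OF order_refl tendsto_const])
  have "\<exists>K \<subseteq> balanced_words n. card K = 2 ^ nat \<lfloor>real n * 0\<rfloor> \<and>
      (\<forall>d. ml_decoder m q n K d \<longrightarrow> max_error_prob m p n K d \<le> 0)" for n
  proof -
    have "0 < real (card (balanced_words n))"
      using card_balanced_words[of n] by (rule less_le_trans[rotated]) simp
    then obtain x where x: "x \<in> balanced_words n" by fastforce
    have "max_error_prob m p n {x} d \<le> 0" if "ml_decoder m q n {x} d" for d
    proof -
      have "{y. y \<in> output_words m n \<and> d y \<noteq> x} = {}"
        using that by (auto simp: ml_decoder_def is_arg_max_def)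
      then have "error_prob m p n d x = 0" by (simp only: error_prob_def sum.empty)
      then show ?thesis by (simp add: max_error_prob_def)
    qed
    with x show ?thesis by (intro exI[of _ "{x}"]) simp
  qed
  then show "\<forall>\<^sub>F n in sequentially. \<exists>K \<subseteq> balanced_words n. card K = 2 ^ nat \<lfloor>real n * 0\<rfloor> \<and>
      (\<forall>d. ml_decoder m q n K d \<longrightarrow> max_error_prob m p n K d \<le> 0)" by simp
qed

lemma achievable_below_capacity:
  assumes R: "0 \<le> R" "R < capacity"
  shows "achievable m p q R"
proof -
  \<comment> \<open>Half the gap: the exponent \<open>n * R - n * (capacity - \<delta>)\<close>
    becomes \<open>- n * \<delta>\<close>, which dominates the \<open>sqrt n\<close>
    correction.\<close>
  define \<delta> where "\<delta> = (capacity - R) / 2"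
  define D where "D = \<bar>mean_score 1 - mean_score 2\<bar>"
  define b where "b n = score_variance / (real n * \<delta>\<^sup>2) + 16 * 2 powr (sqrt (real n) * D - real n * \<delta>)"
    for n
  have \<delta>: "0 < \<delta>" using R by (simp add: \<delta>_def)
  have M_le: "real (2 ^ nat \<lfloor>real n * R\<rfloor>) \<le> 2 powr (real n * R)" for n
  proof -
    have "real (2 ^ nat \<lfloor>real n * R\<rfloor>) = 2 powr real (nat \<lfloor>real n * R\<rfloor>)"
      by (simp add: powr_realpow)
    also have "\<dots> \<le> 2 powr (real n * R)" using R by (intro powr_mono) auto
    finally show ?thesis .
  qed
  show ?thesis
  proof (rule achievableI[OF R(1)])
    have "(\<lambda>n. V / (real n * \<delta>\<^sup>2)) \<longlonglongrightarrow> 0" for V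
      using \<delta> by real_asymp
    moreover have "(\<lambda>n. 16 * 2 powr (sqrt (real n) * D - real n * \<delta>)) \<longlonglongrightarrow> 0"
      using \<delta> by real_asymp
    ultimately show "b \<longlonglongrightarrow> 0"
      unfolding b_def using tendsto_add by fastforce
    have "(\<lambda>n. 2 powr (- (real n * e))) \<longlonglongrightarrow> 0" if "0 < e" for e :: real
      using that by real_asymp
    moreover have "0 < 1 - R" using R capacity_le_1 by simp
    ultimately have "(\<lambda>n. 2 powr (- (real n * (1 - R)))) \<longlonglongrightarrow> 0" by blast
    \<comment> \<open>3/16 is the 3/4 of \<open>balanced_code_exists\<close> divided by its factor
      4.\<close>
    then have "\<forall>\<^sub>F n in sequentially. 2 powr (- (real n * (1 - R))) < 3/16"
      by (rule order_tendstoD) simp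
    then have "\<forall>\<^sub>F n in sequentially. 4 * 2 powr (real n * R) \<le> 3/4 * 2 powr real n"
    proof eventually_elim
      case (elim n)
      have "2 powr (real n * R) = 2 powr (- (real n * (1 - R))) * 2 powr real n"
        by (simp add: powr_add[symmetric] algebra_simps)
      also have "\<dots> \<le> 3/16 * 2 powr real n"
        using elim by (intro mult_right_mono) auto
      finally show ?case by simp
    qed
    then show "\<forall>\<^sub>F n in sequentially. \<exists>K \<subseteq> balanced_words n. card K = 2 ^ nat \<lfloor>real n * R\<rfloor> \<and>
      (\<forall>d. ml_decoder m q n K d \<longrightarrow> max_error_prob m p n K d \<le> b n)"
      using eventually_gt_at_top[of 0]
    proof eventually_elim
      case (elim n)
      let ?M = "2 ^ nat \<lfloor>real n * R\<rfloor> :: nat"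
      have "4 * real ?M \<le> 3/4 * 2 ^ n"
        using elim(1) M_le[of n] by (simp add: powr_realpow)
      from balanced_code_exists[OF elim(2) \<delta> _ this]
      obtain K where K: "K \<subseteq> balanced_words n" "card K = ?M"
        and err: "\<And>d. ml_decoder m q n K d \<Longrightarrow> max_error_prob m p n K d \<le>
          score_variance / (real n * \<delta>\<^sup>2) + 16 * real ?M *
          2 powr (sqrt (real n) * D - real n * (capacity - \<delta>))"
        unfolding D_def by auto
      have "real ?M * 2 powr (sqrt (real n) * D - real n * (capacity - \<delta>))
          \<le> 2 powr (real n * R) * 2 powr (sqrt (real n) * D - real n * (capacity - \<delta>))"
        by (intro mult_right_mono M_le) simp
      also have "\<dots> = 2 powr (sqrt (real n) * D - real n * \<delta>)"
        unfolding powr_add[symmetric] \<delta>_def by (simp add: field_simps)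
      finally have "max_error_prob m p n K d \<le> b n" if "ml_decoder m q n K d" for d
        using err[OF that] by (simp add: b_def)
      with K show ?case by blast
    qed
  qed
qed

text \<open>Were the supremum smaller, some real \<open>R\<close> would lie strictly between it and
  \<open>capacity\<close>. By \<open>achievable_0\<close> this \<open>R\<close> is nonnegative,
  hence achievable, although it exceeds the supremum.\<close>

lemma capacity_le_max_achievable_rate: "ereal capacity \<le> max_achievable_rate m p q"
proof (rule ccontr)
  assume "\<not> ?thesis"
  then have less: "max_achievable_rate m p q < ereal capacity" by simp
  have bound: "ereal R \<le> max_achievable_rate m p q" if "achievable m p q R" for R
    unfolding max_achievable_rate_def using that by (intro SUP_upper) simp
  obtain R where R: "max_achievable_rate m p q < ereal R" "R < capacity"
    using ereal_dense2[OF less] by auto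
  moreover have "0 \<le> R"
    using bound[OF achievable_0] R(1) by (metis ereal_less_eq(3) less_imp_le order_trans zero_ereal_def)
  ultimately show False
    using bound[OF achievable_below_capacity] by (simp add: leD)
qed

end

theorem theorem1:
  fixes m :: nat and p q :: "nat \<Rightarrow> nat \<Rightarrow> real"
  assumes "transition_probs m p" and "transition_probs m q"
  shows "mismatch_rate m p q \<le> max_achievable_rate m p q"
proof (cases "\<exists>i\<in>{1,2}. \<exists>j\<in>{1..m}. p i j > 0 \<and> q i j = 0")
  case True
  then show ?thesis unfolding mismatch_rate_def by simp
next
  case False
  then interpret mismatched_channel m p q
    using assms by unfold_locales auto
  show ?thesis
    unfolding mismatch_rate_eq by (rule capacity_le_max_achievable_rate)
qed

end
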